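(* Let $t\in\mathbb{R}$ and let $\mathbf{v}=(x,y,z)\in\kappa^{-1}(t)\cap\mathbb{R}_+^3$ be a fixed starting point. The left Dehn twist about $\alpha$, acting in trace coordinates by $\tilde T_\alpha(x,y,z)=(x,\,xy-z,\,y)$, can be extended to a continuous flow in trace coordinates given by the map $$F_\alpha^{\mathrm{tr}}(\mathbf{v}):\mathbb{R}\to\mathbb{R}^3,\qquad r\mapsto\begin{pmatrix}x\\ y_\alpha(r)\\ y_\alpha(r-1)\end{pmatrix},$$ where $y_\alpha:\mathbb{R}\to\mathbb{R}$ is given by $$y_\alpha(r)=\begin{cases}C_+^\alpha(\mathbf{v})\,S_+^\alpha(\mathbf{v})^r+C_-^\alpha(\mathbf{v})\,S_-^\alpha(\mathbf{v})^r & \text{if } x\neq 2,\\ y+(y-z)r & \text{if } x=2,\end{cases}$$ with $$C_\pm^\alpha(\mathbf{v})=\frac{y(x^2-4)\pm(xy-2z)\sqrt{x^2-4}}{2(x^2-4)},\qquad S_\pm^\alpha(\mathbf{v})=\frac{x\pm\sqrt{x^2-4}}{2}.$$ Moreover, $F_\alpha^{\mathrm{tr}}(\mathbf{v})(n)=\tilde T_\alpha^n(\mathbf{v})$ for all $n\in\mathbb{Z}$.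
   Context: $\mathbb{R}_+$ denotes the positive reals. $S_{1,1}$ is the once-punctured torus, with $\pi_1(S_{1,1})$ free on $\alpha,\beta$. The $\mathrm{SL}_2(\mathbb{C})$-character variety of $\pi_1(S_{1,1})$ is identified with $\mathbb{C}^3$ by the trace coordinates $(x,y,z)=(\mathrm{tr}\,\rho(\alpha),\mathrm{tr}\,\rho(\beta),\mathrm{tr}\,\rho(\alpha\beta))$. Let $\kappa(x,y,z)=x^2+y^2+z^2-xyz-2$, which is the trace of $\rho(\alpha\beta\alpha^{-1}\beta^{-1})$, and $\kappa^{-1}(t)$ its level set. The left Dehn twist $T_\alpha$ about $\alpha$ acts on $\pi_1(S_{1,1})$ by $\alpha\mapsto\alpha$, $\beta\mapsto\beta\alpha^{-1}$, and the associated polynomial automorphism of trace coordinates is $\tilde T_\alpha(x,y,z)=(x,xy-z,y)$, with inverse $\tilde T_\alpha^{-1}(x,y,z)=(x,z,xz-y)$. For $0<x<2$ the number $\sqrt{x^2-4}$ is the imaginary number $i\sqrt{4-x^2}$ and the powers $S_\pm^r$ are taken with the principal branch (so $S_\pm=e^{\pm i\theta}$ with $\theta\in(0,\pi/2)$ and $S_\pm^r=e^{\pm ir\theta}$). "Continuous flow" means: $r\mapsto F_\alpha^{\mathrm{tr}}(\mathbf{v})(r)$ is continuous, $F_\alpha^{\mathrm{tr}}(\mathbf{v})(0)=\mathbf{v}$, and $F_\alpha^{\mathrm{tr}}\big(F_\alpha^{\mathrm{tr}}(\mathbf{v})(r)\big)(r')=F_\alpha^{\mathrm{tr}}(\mathbf{v})(r+r')$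 for $r,r'\in\mathbb{R}$, where the same formulas are applied at the point $F_\alpha^{\mathrm{tr}}(\mathbf{v})(r)$ (whose first coordinate is again $x$). *)

theory Defs
  imports "HOL-Analysis.Analysis"
begin

type_synonym trace_point = "real \<times> real \<times> real"

fun kappa :: "trace_point \<Rightarrow> real" where
  "kappa (x, y, z) = x\<^sup>2 + y\<^sup>2 + z\<^sup>2 - x * y * z - 2"

definition pos_octant :: "trace_point set" where
  "pos_octant = {(x, y, z). 0 < x \<and> 0 < y \<and> 0 < z}"

text \<open>
  The left Dehn twist about \<open>\<alpha>\<close> sends \<open>\<alpha>\<close> to \<open>\<alpha>\<close> and \<open>\<beta>\<close> to \<open>\<beta> \<alpha>\<inverse>\<close>. The trace
  identity \<open>tr (\<beta> \<alpha>\<inverse>) = tr \<alpha> tr \<beta> - tr (\<alpha> \<beta>)\<close> in \<open>SL\<^sub>2\<close> gives its action on the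
  coordinates \<open>(tr \<alpha>, tr \<beta>, tr (\<alpha> \<beta>))\<close>.
\<close>

fun twist :: "trace_point \<Rightarrow> trace_point" where
  "twist (x, y, z) = (x, x * y - z, y)"

lemma bij_twist: "bij twist"
  and inv_twist: "inv twist (x, y, z) = (x, z, x * z - y)"
proof -
  let ?g = "\<lambda>(x, y, z). (x, z, x * z - y) :: trace_point"
  have gf: "?g \<circ> twist = id" and fg: "twist \<circ> ?g = id"
    by (auto simp: fun_eq_iff)
  show "bij twist"
    using o_bij [OF gf fg] .
  have "inv twist = ?g"
    using inv_unique_comp [OF fg gf] .
  then show "inv twist (x, y, z) = (x, z, x * z - y)"
    by simp
qed

definition twist_power :: "int \<Rightarrow> trace_point \<Rightarrow> trace_point" where
  "twist_power n = (if 0 \<le> n then twist ^^ nat n else inv twist ^^ nat (- n))"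

text \<open>
  For \<open>0 < x < 2\<close> the radicand is negative, so the square root, and with it
  \<open>C\<^sub>\<plusminus>\<close> and \<open>S\<^sub>\<plusminus>\<close>, is taken in the complex numbers: \<^const>\<open>csqrt\<close> then yields
  \<open>\<i> sqrt (4 - x\<^sup>2)\<close>. Complex \<^const>\<open>powr\<close> uses the principal branch.
\<close>

definition root_disc :: "real \<Rightarrow> complex" where
  "root_disc x = csqrt (of_real (x\<^sup>2 - 4))"

fun C_plus :: "trace_point \<Rightarrow> complex" where
  "C_plus (x, y, z) =
     (of_real (y * (x\<^sup>2 - 4)) + of_real (x * y - 2 * z) * root_disc x)
       / of_real (2 * (x\<^sup>2 - 4))"

fun C_minus :: "trace_point \<Rightarrow> complex" where
  "C_minus (x, y, z) =
     (of_real (y * (x\<^sup>2 - 4)) - of_real (x * y - 2 * z) * root_disc x)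
       / of_real (2 * (x\<^sup>2 - 4))"

fun S_plus :: "trace_point \<Rightarrow> complex" where
  "S_plus (x, y, z) = (of_real x + root_disc x) / 2"

fun S_minus :: "trace_point \<Rightarrow> complex" where
  "S_minus (x, y, z) = (of_real x - root_disc x) / 2"

fun y_formula :: "trace_point \<Rightarrow> real \<Rightarrow> complex" where
  "y_formula (x, y, z) r =
     (if x \<noteq> 2 then
        C_plus (x, y, z) * S_plus (x, y, z) powr of_real r
          + C_minus (x, y, z) * S_minus (x, y, z) powr of_real r
      else of_real (y + (y - z) * r))"

text \<open>
  Taking the real part only fixes the codomain; that \<^const>\<open>y_formula\<close> is real at the
  points in question has to be proved separately.
\<close>

definition y_alpha :: "trace_point \<Rightarrow> real \<Rightarrow> real" where
  "y_alpha v r = Re (y_formula v r)"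

definition twist_flow :: "trace_point \<Rightarrow> real \<Rightarrow> trace_point" where
  "twist_flow v r = (fst v, y_alpha v r, y_alpha v (r - 1))"

end

theory Submission imports Defs begin

text \<open>
  The twist turns \<open>(y\<^sub>r, y\<^bsub>r-1\<^esub>)\<close> into \<open>(x y\<^sub>r - y\<^bsub>r-1\<^esub>, y\<^sub>r)\<close>, so iterating it solves the linear
  recurrence \<open>y\<^bsub>r+1\<^esub> = x y\<^sub>r - y\<^bsub>r-1\<^esub>\<close>, whose characteristic polynomial \<open>s\<^sup>2 - x s + 1\<close> has the
  roots \<open>S\<^sub>\<plusminus>\<close> with \<open>S\<^sub>+ S\<^sub>- = 1\<close> and \<open>S\<^sub>+ - S\<^sub>- = D\<close>, the root of the discriminant \<open>x\<^sup>2 - 4\<close>.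

  For \<open>x > 0\<close> both roots lie in the open right half-plane, away from the branch cut, so that their
  principal powers commute with complex conjugation. Conjugation either fixes \<open>D\<close>, and with it
  \<open>S\<^sub>\<plusminus>\<close> and \<open>C\<^sub>\<plusminus>\<close>, or negates \<open>D\<close> and thereby interchanges the two summands of \<open>y\<^sub>\<alpha>(r)\<close>;
  either way \<open>y\<^sub>\<alpha>(r)\<close> is real (\<open>of_real_y_alpha\<close>).

  The coefficients are the solution of \<open>C\<^sub>+ + C\<^sub>- = y\<close>, \<open>C\<^sub>+ S\<^sub>- + C\<^sub>- S\<^sub>+ = z\<close>, that is,
  \<open>C\<^sub>+ = (y S\<^sub>+ - z) / D\<close> and \<open>C\<^sub>- = (z - y S\<^sub>-) / D\<close>. Moving the starting point along the flow for
  a time \<open>r\<close> just multiplies \<open>C\<^sub>\<plusminus>\<close> by \<open>S\<^sub>\<plusminus>\<^sup>r\<close> (\<open>C_twist_flow\<close>), and since \<open>r \<mapsto> S\<^sub>\<plusminus>\<^sup>r\<close> is a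
  homomorphism, this is the flow law. The recurrence holds at all real times, not only at integers:
  applying the twist advances the flow by one unit of time (\<open>twist_twist_flow\<close>), which gives the
  agreement with its integer powers. In the parabolic case \<open>x = 2\<close> the recurrence has the double
  root \<open>1\<close> and the solutions are affine in \<open>r\<close>.
\<close>

section \<open>The characteristic roots\<close>

lemma root_disc_square: "(root_disc x)\<^sup>2 = of_real (x\<^sup>2 - 4)"
  by (simp add: root_disc_def)

lemma root_disc_nonzero:
  assumes "0 < x" "x \<noteq> 2"
  shows "root_disc x \<noteq> 0"
proof -
  have "x\<^sup>2 \<noteq> 2\<^sup>2"
    using assms by (subst power2_eq_iff) auto
  then show ?thesis
    by (simp add: root_disc_def del: of_real_diff of_real_power)
qed

lemma root_disc_imaginary:
  assumes "0 < x" "x < 2"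
  shows "root_disc x = \<i> * of_real (sqrt (4 - x\<^sup>2))"
proof -
  have "x\<^sup>2 < 2\<^sup>2"
    using assms by (intro power_strict_mono) auto
  then show ?thesis
    by (simp add: root_disc_def)
qed

lemma root_disc_real:
  assumes "2 \<le> x"
  shows "root_disc x = of_real (sqrt (x\<^sup>2 - 4))"
proof -
  have "2\<^sup>2 \<le> x\<^sup>2"
    using assms by (intro power_mono) auto
  then show ?thesis
    by (simp add: root_disc_def csqrt_of_real del: of_real_diff of_real_power)
qed

lemma cnj_root_disc:
  assumes "0 < x"
  shows "cnj (root_disc x) = root_disc x \<or> cnj (root_disc x) = - root_disc x"
  using assms root_disc_imaginary [of x] root_disc_real [of x] by (cases "x < 2") auto

text \<open>
  The root of the discriminant is either imaginary or smaller than \<open>x\<close>; hence \<open>S\<^sub>\<plusminus>\<close> have positive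
  real part and stay off the branch cut of the power function.
\<close>

lemma Re_root_disc_bound:
  assumes "0 < x"
  shows "\<bar>Re (root_disc x)\<bar> < x"
proof (cases "x < 2")
  case True
  then show ?thesis
    using assms by (simp add: root_disc_imaginary)
next
  case False
  have "sqrt (x\<^sup>2 - 4) < sqrt (x\<^sup>2)"
    by (simp only: real_sqrt_less_iff)
  moreover have "2\<^sup>2 \<le> x\<^sup>2"
    using False by (intro power_mono) auto
  ultimately show ?thesis
    using assms False by (simp add: root_disc_real)
qed

lemma Re_S_pos:
  assumes "0 < x"
  shows "0 < Re (S_plus (x, y, z))" "0 < Re (S_minus (x, y, z))"
  using Re_root_disc_bound [OF assms] by auto

lemma S_sum: "S_plus (x, y, z) + S_minus (x, y, z) = of_real x"
  by (simp add: field_simps)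

lemma S_diff: "S_plus (x, y, z) - S_minus (x, y, z) = root_disc x"
  by (simp add: field_simps)

lemma S_mult: "S_plus (x, y, z) * S_minus (x, y, z) = 1"
proof -
  have "S_plus (x, y, z) * S_minus (x, y, z) = ((of_real x)\<^sup>2 - (root_disc x)\<^sup>2) / 4"
    by (simp add: field_simps power2_eq_square)
  also have "\<dots> = 1"
    by (simp add: root_disc_square)
  finally show ?thesis .
qed

section \<open>Reality of the formula\<close>

text \<open>
  The two cases are those of a real and of an imaginary \<open>D\<close>: conjugation fixes both summands, or it
  exchanges them.
\<close>

lemma cnj_y_formula:
  assumes "0 < x"
  shows "cnj (y_formula (x, y, z) r) = y_formula (x, y, z) r"
proof (cases "x = 2")
  case True
  then show ?thesis by simp
next
  case False
  note cnj_powers =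
    cnj_powr [OF less_imp_le, OF Re_S_pos(1) [OF assms]]
    cnj_powr [OF less_imp_le, OF Re_S_pos(2) [OF assms]]
  have expand: "cnj (y_formula (x, y, z) r) =
      cnj (C_plus (x, y, z)) * cnj (S_plus (x, y, z)) powr of_real r
        + cnj (C_minus (x, y, z)) * cnj (S_minus (x, y, z)) powr of_real r"
    using False cnj_powers by (simp del: C_plus.simps C_minus.simps S_plus.simps S_minus.simps)
  consider "cnj (root_disc x) = root_disc x" | "cnj (root_disc x) = - root_disc x"
    using cnj_root_disc [OF assms] by blast
  then show ?thesis
  proof cases
    case 1
    then have "cnj (S_plus (x, y, z)) = S_plus (x, y, z)" "cnj (S_minus (x, y, z)) = S_minus (x, y, z)"
      "cnj (C_plus (x, y, z)) = C_plus (x, y, z)" "cnj (C_minus (x, y, z)) = C_minus (x, y, z)"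
      by simp_all
    then show ?thesis
      unfolding expand using False by simp
  next
    case 2
    then have "cnj (S_plus (x, y, z)) = S_minus (x, y, z)" "cnj (S_minus (x, y, z)) = S_plus (x, y, z)"
      "cnj (C_plus (x, y, z)) = C_minus (x, y, z)" "cnj (C_minus (x, y, z)) = C_plus (x, y, z)"
      by simp_all
    then show ?thesis
      unfolding expand using False by simp
  qed
qed

lemma of_real_y_alpha:
  assumes "0 < fst v"
  shows "complex_of_real (y_alpha v r) = y_formula v r"
proof -
  obtain x y z where v: "v = (x, y, z)"
    by (cases v)
  have "y_formula v r \<in> \<real>"
    using cnj_y_formula [of x y z r] assms by (simp only: v Reals_cnj_iff fst_conv)
  then show ?thesis
    by (simp add: y_alpha_def)
qed

section \<open>Coefficients as solutions of the initial value problem\<close>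

text \<open>
  The right-hand sides are linear in \<open>(y, z)\<close>, which makes the effect of the flow on the
  coefficients computable.
\<close>

lemma C_plus_eq:
  assumes "0 < x" "x \<noteq> 2"
  shows "C_plus (x, y, z) = (of_real y * S_plus (x, y, z) - of_real z) / root_disc x"
proof -
  have "C_plus (x, y, z) = (of_real y * (root_disc x)\<^sup>2 + of_real (x * y - 2 * z) * root_disc x)
      / (2 * (root_disc x)\<^sup>2)"
    by (simp add: root_disc_square)
  also have "\<dots> = (of_real y * S_plus (x, y, z) - of_real z) / root_disc x"
    using root_disc_nonzero [OF assms] by (simp add: field_simps power2_eq_square)
  finally show ?thesis .
qed

lemma C_minus_eq:
  assumes "0 < x" "x \<noteq> 2"
  shows "C_minus (x, y, z) = (of_real z - of_real y * S_minus (x, y, z)) / root_disc x"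
proof -
  have "C_minus (x, y, z) = (of_real y * (root_disc x)\<^sup>2 - of_real (x * y - 2 * z) * root_disc x)
      / (2 * (root_disc x)\<^sup>2)"
    by (simp add: root_disc_square)
  also have "\<dots> = (of_real z - of_real y * S_minus (x, y, z)) / root_disc x"
    using root_disc_nonzero [OF assms] by (simp add: field_simps power2_eq_square)
  finally show ?thesis .
qed

lemma S_fiber:
  "S_plus (x, y, z) = S_plus (x, y', z')" "S_minus (x, y, z) = S_minus (x, y', z')"
  by simp_all

\<comment> \<open>
  From here on only the linear expressions for the coefficients and the sum, difference and product
  of the roots matter; unfolding the closed forms would hide these relations.
\<close>
declare C_plus.simps [simp del] C_minus.simps [simp del]
  S_plus.simps [simp del] S_minus.simps [simp del]

lemma S_nonzero: "S_plus (x, y, z) \<noteq> 0" "S_minus (x, y, z) \<noteq> 0"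
  using S_mult [of x y z] by auto

lemma S_powr_shift:
  "S_plus (x, y, z) powr of_real (r - 1) = S_plus (x, y, z) powr of_real r * S_minus (x, y, z)"
  "S_minus (x, y, z) powr of_real (r - 1) = S_minus (x, y, z) powr of_real r * S_plus (x, y, z)"
  using S_nonzero [of x y z] S_mult [of x y z]
  by (simp_all add: powr_diff divide_eq_eq mult.assoc) (simp add: mult.commute)

text \<open>
  Flowing for a time \<open>r\<close> acts diagonally on the pair \<open>(C\<^sub>+, C\<^sub>-)\<close>. Substituting the position at
  time \<open>r\<close> into the linear expressions for the coefficients, one of the two summands cancels and
  the other is left with the factor \<open>(S\<^sub>+ - S\<^sub>-) / D = 1\<close>.
\<close>

lemma C_twist_flow:
  assumes "0 < x" "x \<noteq> 2"
  shows "C_plus (twist_flow (x, y, z) r) = C_plus (x, y, z) * S_plus (x, y, z) powr of_real r"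
    and "C_minus (twist_flow (x, y, z) r) = C_minus (x, y, z) * S_minus (x, y, z) powr of_real r"
proof -
  let ?S = "S_plus (x, y, z)" and ?T = "S_minus (x, y, z)"
  define A B where "A = C_plus (x, y, z) * ?S powr of_real r"
    and "B = C_minus (x, y, z) * ?T powr of_real r"
  define y' z' where "y' = y_alpha (x, y, z) r" and "z' = y_alpha (x, y, z) (r - 1)"
  have flow: "twist_flow (x, y, z) r = (x, y', z')"
    by (simp add: twist_flow_def y'_def z'_def)
  have y: "complex_of_real y' = A + B"
    using assms by (simp add: y'_def A_def B_def of_real_y_alpha)
  have z: "complex_of_real z' = A * ?T + B * ?S"
    using assms
    by (simp add: z'_def A_def B_def of_real_y_alpha S_powr_shift mult.assoc del: of_real_diff)
  have "C_plus (x, y', z') = ((A + B) * ?S - (A * ?T + B * ?S)) / root_disc x"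
    by (simp only: C_plus_eq [OF assms, of y' z'] y z S_fiber [of x y' z' y z])
  also have "\<dots> = A * (?S - ?T) / root_disc x"
    by (simp add: algebra_simps)
  finally show "C_plus (twist_flow (x, y, z) r) = C_plus (x, y, z) * ?S powr of_real r"
    using root_disc_nonzero [OF assms] by (simp add: flow S_diff A_def)
  have "C_minus (x, y', z') = ((A * ?T + B * ?S) - (A + B) * ?T) / root_disc x"
    by (simp only: C_minus_eq [OF assms, of y' z'] y z S_fiber [of x y' z' y z])
  also have "\<dots> = B * (?S - ?T) / root_disc x"
    by (simp add: algebra_simps)
  finally show "C_minus (twist_flow (x, y, z) r) = C_minus (x, y, z) * ?T powr of_real r"
    using root_disc_nonzero [OF assms] by (simp add: flow S_diff B_def)
qed

section \<open>The flow and its time-one map\<close>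

lemma fst_twist_flow [simp]: "fst (twist_flow v r) = fst v"
  by (simp add: twist_flow_def)

lemma y_alpha_add:
  assumes "0 < fst v"
  shows "y_alpha (twist_flow v r) r' = y_alpha v (r + r')"
proof -
  obtain x y z where v: "v = (x, y, z)"
    by (cases v)
  show ?thesis
  proof (cases "x = 2")
    case True
    then show ?thesis
      by (simp add: v y_alpha_def twist_flow_def algebra_simps)
  next
    case False
    obtain y' z' where w: "twist_flow v r = (x, y', z')"
      by (simp add: twist_flow_def v)
    have "y_formula (twist_flow v r) r' =
        C_plus (twist_flow v r) * S_plus (x, y, z) powr of_real r'
          + C_minus (twist_flow v r) * S_minus (x, y, z) powr of_real r'"
      using False by (simp add: w S_fiber [of x y' z' y z])
    also have "\<dots> = y_formula v (r + r')"
      using False assms S_nonzero [of x y z]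
      by (simp add: v C_twist_flow powr_add mult.assoc)
    finally show ?thesis
      by (simp add: y_alpha_def)
  qed
qed

lemma twist_flow_add:
  assumes "0 < fst v"
  shows "twist_flow (twist_flow v r) r' = twist_flow v (r + r')"
  using y_alpha_add [OF assms]
  by (simp add: twist_flow_def [of _ r'] twist_flow_def [of _ "r + r'"] algebra_simps)

lemma y_formula_0:
  assumes "0 < x"
  shows "y_formula (x, y, z) 0 = of_real y"
proof (cases "x = 2")
  case False
  have "C_plus (x, y, z) + C_minus (x, y, z)
      = of_real y * (S_plus (x, y, z) - S_minus (x, y, z)) / root_disc x"
    using assms False
    by (simp add: C_plus_eq C_minus_eq add_divide_distrib [symmetric] right_diff_distrib)
  then show ?thesis
    using False S_nonzero root_disc_nonzero [OF assms False] by (simp add: S_diff)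
qed simp

text \<open>
  The recurrence holds along the whole flow because the characteristic roots are inverse to each
  other and have sum \<open>x\<close>.
\<close>

lemma y_formula_recurrence:
  "y_formula (x, y, z) (r + 1)
    = of_real x * y_formula (x, y, z) r - y_formula (x, y, z) (r - 1)"
proof (cases "x = 2")
  case True
  then show ?thesis
    by (simp add: algebra_simps)
next
  case False
  let ?S = "S_plus (x, y, z)" and ?T = "S_minus (x, y, z)"
  have S: "?S powr of_real (r + 1) = ?S powr of_real r * ?S"
    and T: "?T powr of_real (r + 1) = ?T powr of_real r * ?T"
    using S_nonzero by (simp_all add: powr_add)
  show ?thesis
    by (simp only: y_formula.simps if_P [OF False] S T S_powr_shift S_sum [of x y z, symmetric])
      (simp add: algebra_simps)
qed

lemma y_formula_minus_1:
  assumes "0 < x"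
  shows "y_formula (x, y, z) (- 1) = of_real z"
proof (cases "x = 2")
  case False
  let ?S = "S_plus (x, y, z)" and ?T = "S_minus (x, y, z)"
  have "?S powr of_real (- 1) = ?T" "?T powr of_real (- 1) = ?S"
    using S_powr_shift [of x y z 0] S_nonzero by simp_all
  then have "y_formula (x, y, z) (- 1) = C_plus (x, y, z) * ?T + C_minus (x, y, z) * ?S"
    using False by (simp del: of_real_minus)
  also have "\<dots> = of_real z * (?S - ?T) / root_disc x"
    using assms False
    by (simp add: C_plus_eq C_minus_eq add_divide_distrib [symmetric] algebra_simps)
  finally show ?thesis
    using root_disc_nonzero [OF assms False] by (simp add: S_diff)
qed simp

lemma twist_flow_0:
  assumes "0 < fst v"
  shows "twist_flow v 0 = v"
  using assms
  by (cases v) (simp add: twist_flow_def y_alpha_def y_formula_0 y_formula_minus_1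
      del: y_formula.simps)

lemma twist_twist_flow: "twist (twist_flow v r) = twist_flow v (r + 1)"
proof -
  obtain x y z where v: "v = (x, y, z)"
    by (cases v)
  have "y_alpha v (r + 1) = x * y_alpha v r - y_alpha v (r - 1)"
    by (simp add: v y_alpha_def y_formula_recurrence del: y_formula.simps)
  then show ?thesis
    by (simp add: twist_flow_def v)
qed

lemma inv_twist_twist_flow: "inv twist (twist_flow v r) = twist_flow v (r - 1)"
  using twist_twist_flow [of v "r - 1"] bij_is_inj [OF bij_twist] by (simp add: inv_f_eq)

lemma twist_flow_of_int:
  assumes "0 < fst v"
  shows "twist_flow v (of_int n) = twist_power n v"
proof -
  have pos: "(twist ^^ k) v = twist_flow v (real k)" for k
    using assms by (induction k) (simp_all add: twist_flow_0 twist_twist_flow add.commute)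
  have neg: "(inv twist ^^ k) v = twist_flow v (- real k)" for k
  proof (induction k)
    case 0
    show ?case
      by (simp add: twist_flow_0 [OF assms])
  next
    case (Suc k)
    have "- real (Suc k) = - real k - 1"
      by simp
    then show ?case
      by (simp only: funpow.simps o_apply Suc.IH inv_twist_twist_flow)
  qed
  show ?thesis
    by (simp add: twist_power_def pos neg)
qed

lemma continuous_on_y_alpha: "continuous_on UNIV (y_alpha v)"
proof -
  obtain x y z where v: "v = (x, y, z)"
    by (cases v)
  show ?thesis
  proof (cases "x = 2")
    case True
    then show ?thesis
      by (auto simp: v y_alpha_def [abs_def] intro!: continuous_intros)
  next
    case False
    then show ?thesis
      using S_nonzero
      by (auto simp: v y_alpha_def [abs_def] powr_def intro!: continuous_intros)
  qed
qed

lemma continuous_on_twist_flow: "continuous_on UNIV (twist_flow v)"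
  unfolding twist_flow_def [abs_def]
  by (intro continuous_intros continuous_on_compose2 [OF continuous_on_y_alpha]) auto

theorem theorem3p1p2:
  fixes t :: real and v :: trace_point
  assumes "v \<in> kappa -` {t} \<inter> pos_octant"
  shows "(\<forall>r. complex_of_real (y_alpha v r) = y_formula v r)
    \<and> (\<forall>s r. complex_of_real (y_alpha (twist_flow v s) r) = y_formula (twist_flow v s) r)
    \<and> continuous_on UNIV (twist_flow v)
    \<and> twist_flow v 0 = v
    \<and> (\<forall>r r'. twist_flow (twist_flow v r) r' = twist_flow v (r + r'))
    \<and> (\<forall>n :: int. twist_flow v (of_int n) = twist_power n v)"
proof -
  have "0 < fst v"
    using assms by (auto simp: pos_octant_def)
  then show ?thesis
    by (simp add: of_real_y_alpha continuous_on_twist_flow twist_flow_0 twist_flow_add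
        twist_flow_of_int)
qed

end
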